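(* Let $(X_\sigma,f_\sigma)_{\sigma\in A}$ be a combinatorial Seshadri stratification on $X_P$, with weights $\mu_\sigma$ of $f_\sigma$ and associated quasi-valuation $\nu$. Let $g\in\mathbb K[\hat X_P]\setminus\{0\}$ be a $\hat T$-eigenfunction of weight $\lambda_g$ with $\deg g\ge1$, and let $\mathfrak C=(\sigma_r,\ldots,\sigma_0)$ be a maximal chain in $A$ such that $\frac{-\lambda_g}{\deg g}\in\Delta_{\mathfrak C}$. If $$\frac{-\lambda_g}{\deg g}=\sum_{\sigma\in\mathfrak C}a_\sigma\frac{-\mu_\sigma}{\deg f_\sigma}$$ is an expression of $\frac{-\lambda_g}{\deg g}$ as a convex linear combination of the vertices of $\Delta_{\mathfrak C}$, then $$\nu(g)=\sum_{\sigma\in\mathfrak C}\frac{a_\sigma\deg g}{\deg f_\sigma}\,e_\sigma .$$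
   Context: Toric variety. $\mathbb K$ is an algebraically closed field of characteristic zero, $T\simeq(\mathbb K^* )^n$ is a torus with character lattice $M$, $M_{\mathbb R}=M\otimes_{\mathbb Z}\mathbb R$. $P\subseteq M_{\mathbb R}$ is a full dimensional normal lattice polytope, $\Lambda=P\cap M$, $V=\mathbb K^\Lambda$ with standard basis $\{e_\chi\}_{\chi\in\Lambda}$ and dual coordinates $x_\chi$. $X_P\subseteq\mathbb P(V)$ is the Zariski closure of the image of $T\to\mathbb P(V)$, $t\mapsto[\sum_{\chi\in\Lambda}\chi(t)e_\chi]$; $\hat X_P\subseteq V$ is its affine cone and $\mathbb K[\hat X_P]$ the coordinate ring of the cone (the homogeneous coordinate ring of $X_P$), graded by degree. $\hat T=\mathbb K^*\times T$, with character lattice $\hat M=\mathbb Z\oplus M$, acts on $V$ by $(c,t)\cdot e_\chi=c\chi(t)e_\chi$ and on functions by $(\hat t\cdot g)(x)=g(\hat t^{-1}x)$; so $x_\chi|_{\hat X_P}$ has weight $(-1,-\chi)$. A (nonzero) $\hat T$-eigenfunction $g$ is homogeneous and its weight $\lambda_g$ has first entry $-\deg g$. $M_{\mathbb R}$ is identified with $\{1\}\times M_{\mathbb R}\subset\mathbb R\oplus M_{\mathbb R}$. Stratification and triangulation. $A$ is the set of (nonempty) faces of $P$, including $P$, ordered by inclusion; $\sigma^o$ is the relative interior of $\sigma$; $X_\sigma$ is the Zariski closure of the $T$-orbit $\{[\sum_{\chi\in\Lambda\cap\sigma}\chi(t)e_\chi]\mid t\in T\}$. A combinatorial Seshadri stratification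 on $X_P$ is a collection $(X_\sigma,f_\sigma)_{\sigma\in A}$ where each $f_\sigma\in\mathbb K[\hat X_P]\setminus\{0\}$ is a $\hat T$-eigenfunction with $\deg f_\sigma\ge1$ whose $\hat T$-weight $\mu_\sigma$ satisfies $\frac{-\mu_\sigma}{\deg f_\sigma}\in\sigma^o$. For a maximal chain $\mathfrak C$ in $A$, $\Delta_{\mathfrak C}$ is the simplex which is the convex hull of the points $\frac{-\mu_\sigma}{\deg f_\sigma}$, $\sigma\in\mathfrak C$. Quasi-valuation. For a maximal chain $\mathfrak C=\{\sigma_r>\dots>\sigma_0\}$ in $A$ the weights $\mu_{\sigma_r},\dots,\mu_{\sigma_0}$ form a $\mathbb Q$-basis of $\hat M_{\mathbb Q}$. $\mathbb Q^{\mathfrak C}$ is the subspace of $\mathbb Q^A$ (standard basis $e_\sigma$, $\sigma\in A$) spanned by $e_\sigma$, $\sigma\in\mathfrak C$. For a $\hat T$-eigenfunction $g$ of weight $\lambda_g=\sum_i a_i\mu_{\sigma_i}$ put $\nu_{\mathfrak C}(g)=\sum_i a_ie_{\sigma_i}$; for general $g\ne0$ take the minimum of the values on the $\hat T$-weight components of $g$. The minimum is with respect to the lexicographic order on $\mathbb Q^A$ induced by a fixed total order $>^t$ on $A$ refining the partial order (the coordinate at the $>^t$-largest element is compared first). The quasi-valuation is $\nu(g)=\min\{\nu_{\mathfrak C}(g)\mid\mathfrak C\text{ a maximal chain in }A\}$. *)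

theory Defs
  imports "HOL-Analysis.Analysis" "HOL-Computational_Algebra.Polynomial"
begin

text \<open>
  The torus is \<open>T = (K\<^sup>*)\<^sup>n\<close> with character lattice \<open>M = \<int>\<^sup>n\<close> and \<open>M\<^sub>\<real> = \<real>\<^sup>n\<close>, where \<open>n\<close> is
  the cardinality of the index type \<open>'n\<close>. Accordingly \<open>\<int> \<oplus> M\<close> is the type \<open>int \<times> (int ^ 'n)\<close>.
\<close>

subsection \<open>Lattice polytopes\<close>

definition to_real :: "int ^ 'n \<Rightarrow> real ^ 'n"
  where "to_real u = (\<chi> i. of_int (u $ i))"

definition lattice_points :: "(real ^ 'n) set \<Rightarrow> (int ^ 'n) set"
  where "lattice_points S = {u. to_real u \<in> S}"

definition lattice_polytope :: "(real ^ 'n) set \<Rightarrow> bool"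
  where "lattice_polytope P \<longleftrightarrow> (\<exists>S. finite S \<and> P = convex hull (to_real ` S))"

definition dilate :: "nat \<Rightarrow> (real ^ 'n) set \<Rightarrow> (real ^ 'n) set"
  where "dilate k P = (\<lambda>x. real k *\<^sub>R x) ` P"

definition normal_polytope :: "(real ^ 'n) set \<Rightarrow> bool"
  where "normal_polytope P \<longleftrightarrow>
    (\<forall>k l. {u + v | u v. u \<in> lattice_points (dilate k P) \<and> v \<in> lattice_points (dilate l P)}
            = lattice_points (dilate (k + l) P))"

definition faces :: "(real ^ 'n) set \<Rightarrow> (real ^ 'n) set set"
  where "faces P = {F. F face_of P \<and> F \<noteq> {}}"


subsection \<open>Tori and characters\<close>

definition torus :: "('k::field ^ 'n) set"
  where "torus = {t. \<forall>i. t $ i \<noteq> 0}"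

definition character :: "int ^ 'n \<Rightarrow> 'k::field ^ 'n \<Rightarrow> 'k"
  where "character u t = (\<Prod>i\<in>UNIV. (t $ i) powi (u $ i))"

definition ext_torus :: "('k::field \<times> ('k ^ 'n)) set"
  where "ext_torus = {c. c \<noteq> 0} \<times> torus"

definition ext_inverse :: "'k::field \<times> ('k ^ 'n) \<Rightarrow> 'k \<times> ('k ^ 'n)"
  where "ext_inverse s = (inverse (fst s), \<chi> i. inverse (snd s $ i))"

definition ext_character :: "int \<times> (int ^ 'n) \<Rightarrow> 'k::field \<times> ('k ^ 'n) \<Rightarrow> 'k"
  where "ext_character l s = (fst s powi fst l) * character (snd l) (snd s)"


subsection \<open>Polynomial functions and projective space\<close>

text \<open>
  For a finite set \<open>L\<close> of lattice points the vector space \<open>K\<^sup>L\<close> consists of the functions on the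
  whole lattice which vanish outside \<open>L\<close>; the coordinate function of \<open>u \<in> L\<close> is \<open>\<lambda>v. v u\<close>.
  Polynomials are treated as functions, which is harmless over an infinite field.
\<close>

type_synonym ('n, 'k) vect = "int ^ 'n \<Rightarrow> 'k"
type_synonym ('n, 'k) pfun = "('n, 'k) vect \<Rightarrow> 'k"

definition vspace :: "(int ^ 'n) set \<Rightarrow> ('n, 'k::field) vect set"
  where "vspace L = {v. \<forall>u. u \<notin> L \<longrightarrow> v u = 0}"

definition monomial_fun :: "(int ^ 'n) set \<Rightarrow> (int ^ 'n \<Rightarrow> nat) \<Rightarrow> ('n, 'k::field) pfun"
  where "monomial_fun L m v = (\<Prod>u\<in>L. v u ^ m u)"

definition poly_funs :: "(int ^ 'n) set \<Rightarrow> ('n, 'k::field) pfun set"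
  where "poly_funs L = {(\<lambda>v. \<Sum>m\<in>E. c m * monomial_fun L m v) | E c. finite E}"

definition homog_poly_funs :: "(int ^ 'n) set \<Rightarrow> nat \<Rightarrow> ('n, 'k::field) pfun set"
  where "homog_poly_funs L d =
    {(\<lambda>v. \<Sum>m\<in>E. c m * monomial_fun L m v) | E c. finite E \<and> (\<forall>m\<in>E. (\<Sum>u\<in>L. m u) = d)}"

text \<open>Points of \<open>\<P>(K\<^sup>L)\<close> are lines through the origin, as subsets of \<open>K\<^sup>L\<close> containing the origin.\<close>

definition line_through :: "('n, 'k::field) vect \<Rightarrow> ('n, 'k) vect set"
  where "line_through v = {(\<lambda>u. c * v u) | c. True}"

definition proj_space :: "(int ^ 'n) set \<Rightarrow> ('n, 'k::field) vect set set"
  where "proj_space L = {line_through v | v. v \<in> vspace L \<and> v \<noteq> (\<lambda>_. 0)}"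

definition proj_zeros :: "(int ^ 'n) set \<Rightarrow> ('n, 'k::field) pfun set \<Rightarrow> ('n, 'k) vect set set"
  where "proj_zeros L H = {p \<in> proj_space L. \<forall>h\<in>H. \<forall>v\<in>p. h v = 0}"

definition proj_closed :: "(int ^ 'n) set \<Rightarrow> ('n, 'k::field) vect set set \<Rightarrow> bool"
  where "proj_closed L Z \<longleftrightarrow> (\<exists>H \<subseteq> (\<Union>d. homog_poly_funs L d). Z = proj_zeros L H)"

definition zariski_closure ::
    "(int ^ 'n) set \<Rightarrow> ('n, 'k::field) vect set set \<Rightarrow> ('n, 'k) vect set set"
  where "zariski_closure L Y = \<Inter>{Z. proj_closed L Z \<and> Y \<subseteq> Z}"

definition affine_cone :: "('n, 'k::field) vect set set \<Rightarrow> ('n, 'k) vect set"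
  where "affine_cone X = insert (\<lambda>_. 0) (\<Union>X)"


subsection \<open>The toric variety, its orbit closures and its coordinate ring\<close>

text \<open>The vector \<open>\<Sum> u(t) e\<^sub>u\<close>, where \<open>u\<close> ranges over the lattice points of \<open>F\<close>.\<close>

definition orbit_vector :: "(real ^ 'n) set \<Rightarrow> 'k::field ^ 'n \<Rightarrow> ('n, 'k) vect"
  where "orbit_vector F t = (\<lambda>u. if u \<in> lattice_points F then character u t else 0)"

definition orbit_closure :: "(real ^ 'n) set \<Rightarrow> (real ^ 'n) set \<Rightarrow> ('n, 'k::field) vect set set"
  where "orbit_closure P F =
    zariski_closure (lattice_points P) {line_through (orbit_vector F t) | t. t \<in> torus}"

definition toric_variety :: "(real ^ 'n) set \<Rightarrow> ('n, 'k::field) vect set set"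
  where "toric_variety P = orbit_closure P P"

definition toric_cone :: "(real ^ 'n) set \<Rightarrow> ('n, 'k::field) vect set"
  where "toric_cone P = affine_cone (toric_variety P)"

text \<open>
  The coordinate ring consists of the restrictions of polynomial functions to the cone. Restricted
  functions are represented by their extensions by \<open>0\<close>, so that equality of elements of the ring
  is equality of functions.
\<close>

definition restrict_fun :: "('n, 'k::field) vect set \<Rightarrow> ('n, 'k) pfun \<Rightarrow> ('n, 'k) pfun"
  where "restrict_fun X p = (\<lambda>v. if v \<in> X then p v else 0)"

definition coord_ring :: "(real ^ 'n) set \<Rightarrow> ('n, 'k::field) pfun set"
  where "coord_ring P = restrict_fun (toric_cone P) ` poly_funs (lattice_points P)"

definition coord_ring_deg :: "(real ^ 'n) set \<Rightarrow> nat \<Rightarrow> ('n, 'k::field) pfun set"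
  where "coord_ring_deg P d = restrict_fun (toric_cone P) ` homog_poly_funs (lattice_points P) d"

text \<open>Only meaningful for nonzero homogeneous elements of the coordinate ring.\<close>

definition deg :: "(real ^ 'n) set \<Rightarrow> ('n, 'k::field) pfun \<Rightarrow> nat"
  where "deg P g = (THE d. g \<in> coord_ring_deg P d)"


subsection \<open>Eigenfunctions and weights\<close>

definition act :: "'k::field \<times> ('k ^ 'n) \<Rightarrow> ('n, 'k) vect \<Rightarrow> ('n, 'k) vect"
  where "act s v = (\<lambda>u. fst s * character u (snd s) * v u)"

definition fun_act :: "'k::field \<times> ('k ^ 'n) \<Rightarrow> ('n, 'k) pfun \<Rightarrow> ('n, 'k) pfun"
  where "fun_act s g = (\<lambda>v. g (act (ext_inverse s) v))"

definition weight_space :: "(real ^ 'n) set \<Rightarrow> int \<times> (int ^ 'n) \<Rightarrow> ('n, 'k::field) pfun set"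
  where "weight_space P l =
    {g \<in> coord_ring P. \<forall>s\<in>ext_torus. fun_act s g = (\<lambda>v. ext_character l s * g v)}"

definition eigenfunction :: "(real ^ 'n) set \<Rightarrow> ('n, 'k::field) pfun \<Rightarrow> bool"
  where "eigenfunction P g \<longleftrightarrow> g \<noteq> (\<lambda>_. 0) \<and> (\<exists>l. g \<in> weight_space P l)"

definition weight :: "(real ^ 'n) set \<Rightarrow> ('n, 'k::field) pfun \<Rightarrow> int \<times> (int ^ 'n)"
  where "weight P g = (THE l. g \<in> weight_space P l)"

text \<open>The point \<open>-\<lambda>\<^sub>g / deg g\<close> of \<open>\<real> \<oplus> M\<^sub>\<real>\<close>.\<close>

definition normalized_weight :: "(real ^ 'n) set \<Rightarrow> ('n, 'k::field) pfun \<Rightarrow> real \<times> (real ^ 'n)"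
  where "normalized_weight P g =
    (1 / real (deg P g)) *\<^sub>R (- (of_int (fst (weight P g)), to_real (snd (weight P g))))"

definition weight_components ::
    "(real ^ 'n) set \<Rightarrow> ('n, 'k::field) pfun \<Rightarrow> int \<times> (int ^ 'n) \<Rightarrow> ('n, 'k) pfun"
  where "weight_components P g = (THE h.
    (\<forall>l. h l \<in> weight_space P l) \<and> finite {l. h l \<noteq> (\<lambda>_. 0)} \<and>
    g = (\<lambda>v. \<Sum>l | h l \<noteq> (\<lambda>_. 0). h l v))"


subsection \<open>Combinatorial Seshadri stratifications\<close>

definition comb_seshadri_stratification ::
    "(real ^ 'n) set \<Rightarrow> ((real ^ 'n) set \<Rightarrow> ('n, 'k::field) vect set set) \<Rightarrow>
      ((real ^ 'n) set \<Rightarrow> ('n, 'k) pfun) \<Rightarrow> bool"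
  where "comb_seshadri_stratification P X f \<longleftrightarrow>
    (\<forall>\<sigma>\<in>faces P. X \<sigma> = orbit_closure P \<sigma> \<and> eigenfunction P (f \<sigma>) \<and> deg P (f \<sigma>) \<ge> 1 \<and>
      normalized_weight P (f \<sigma>) \<in> {1} \<times> rel_interior \<sigma>)"

definition chain_simplex ::
    "(real ^ 'n) set \<Rightarrow> ((real ^ 'n) set \<Rightarrow> ('n, 'k::field) pfun) \<Rightarrow> (real ^ 'n) set set \<Rightarrow>
      (real \<times> (real ^ 'n)) set"
  where "chain_simplex P f C = convex hull ((\<lambda>\<sigma>. normalized_weight P (f \<sigma>)) ` C)"


subsection \<open>The quasi-valuation\<close>

text \<open>
  Elements of \<open>\<rat>\<^sup>A\<close> are functions vanishing outside \<open>A\<close>. A pair \<open>(\<sigma>, \<tau>) \<in> r\<close> means that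
  \<open>\<sigma>\<close> is at most \<open>\<tau>\<close> in the chosen total order.
\<close>

definition refines_inclusion :: "'a set set \<Rightarrow> 'a set rel \<Rightarrow> bool"
  where "refines_inclusion A r \<longleftrightarrow>
    linear_order_on A r \<and> (\<forall>\<sigma>\<in>A. \<forall>\<tau>\<in>A. \<sigma> \<subseteq> \<tau> \<longrightarrow> (\<sigma>, \<tau>) \<in> r)"

definition lex_less :: "'a set \<Rightarrow> 'a rel \<Rightarrow> ('a \<Rightarrow> rat) \<Rightarrow> ('a \<Rightarrow> rat) \<Rightarrow> bool"
  where "lex_less A r a b \<longleftrightarrow>
    (\<exists>\<sigma>\<in>A. a \<sigma> < b \<sigma> \<and> (\<forall>\<tau>\<in>A. (\<sigma>, \<tau>) \<in> r \<and> \<tau> \<noteq> \<sigma> \<longrightarrow> a \<tau> = b \<tau>))"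

definition lex_min :: "'a set \<Rightarrow> 'a rel \<Rightarrow> ('a \<Rightarrow> rat) set \<Rightarrow> 'a \<Rightarrow> rat"
  where "lex_min A r S = (THE a. a \<in> S \<and> (\<forall>b\<in>S. b = a \<or> lex_less A r a b))"

text \<open>The coordinates of the weight of an eigenfunction in the basis given by the chain \<open>C\<close>.\<close>

definition eigen_val ::
    "(real ^ 'n) set \<Rightarrow> ((real ^ 'n) set \<Rightarrow> ('n, 'k::field) pfun) \<Rightarrow> (real ^ 'n) set set \<Rightarrow>
      ('n, 'k) pfun \<Rightarrow> (real ^ 'n) set \<Rightarrow> rat"
  where "eigen_val P f C g = (THE a. (\<forall>\<sigma>. \<sigma> \<notin> C \<longrightarrow> a \<sigma> = 0) \<and>
    of_int (fst (weight P g)) = (\<Sum>\<sigma>\<in>C. a \<sigma> * of_int (fst (weight P (f \<sigma>)))) \<and>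
    (\<forall>i. of_int (snd (weight P g) $ i) = (\<Sum>\<sigma>\<in>C. a \<sigma> * of_int (snd (weight P (f \<sigma>)) $ i))))"

definition chain_val ::
    "(real ^ 'n) set \<Rightarrow> ((real ^ 'n) set \<Rightarrow> ('n, 'k::field) pfun) \<Rightarrow> (real ^ 'n) set rel \<Rightarrow>
      (real ^ 'n) set set \<Rightarrow> ('n, 'k) pfun \<Rightarrow> (real ^ 'n) set \<Rightarrow> rat"
  where "chain_val P f r C g = lex_min (faces P) r
    {eigen_val P f C (weight_components P g l) | l. weight_components P g l \<noteq> (\<lambda>_. 0)}"

definition maximal_chains :: "'a set set \<Rightarrow> 'a set set set"
  where "maximal_chains A = {C. subset.maxchain A C}"

definition quasi_val ::
    "(real ^ 'n) set \<Rightarrow> ((real ^ 'n) set \<Rightarrow> ('n, 'k::field) pfun) \<Rightarrow> (real ^ 'n) set rel \<Rightarrow>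
      ('n, 'k) pfun \<Rightarrow> (real ^ 'n) set \<Rightarrow> rat"
  where "quasi_val P f r g = lex_min (faces P) r
    {chain_val P f r C g | C. C \<in> maximal_chains (faces P)}"

definition unit_vec :: "'a \<Rightarrow> 'a \<Rightarrow> real"
  where "unit_vec \<sigma> = (\<lambda>\<tau>. if \<tau> = \<sigma> then 1 else 0)"

end

theory Submission
  imports Defs
begin

text \<open>
  Put \<open>q\<^sub>\<sigma> = -\<mu>\<^sub>\<sigma> / deg f\<^sub>\<sigma>\<close>, a point of \<open>{1} \<times> \<sigma>\<^sup>o\<close>. The argument rests on one fact about the polytope
  (\<open>supporting_functional\<close>): if \<open>D\<close> is a chain of faces none of which contains the face \<open>\<rho>\<close>, then some
  linear form is nonnegative on \<open>{1} \<times> P\<close>, vanishes on all members of \<open>D\<close>, and is positive at \<open>q\<^sub>\<rho>\<close>. It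
  is the form that exposes the largest member of \<open>D\<close>; at \<open>q\<^sub>\<rho>\<close> it cannot vanish, because a face that
  meets the relative interior of \<open>\<rho>\<close> contains \<open>\<rho>\<close>.

  Applied to a linear relation between the \<open>q\<^sub>\<sigma>\<close> of a chain, with \<open>\<rho>\<close> the largest face that occurs in it,
  this form kills every term but that of \<open>\<rho>\<close>. Hence the \<open>q\<^sub>\<sigma>\<close> of a chain are linearly independent
  (\<open>chain_independent\<close>). A maximal chain of faces has \<open>n + 1\<close> members (\<open>card_maximal_chain_faces\<close>), so its
  weights form a basis of the \<open>(n + 1)\<close>-dimensional rational space
  (\<open>rational_coordinates\<close>), and the given convex combination must be the
  expansion of \<open>\<lambda>\<^sub>g\<close> in the basis of \<open>\<CC>\<close>: up to the factors \<open>deg g / deg f\<^sub>\<sigma>\<close>, the \<open>a\<^sub>\<sigma>\<close> are the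
  coordinates of \<open>\<nu>\<^sub>\<CC>(g)\<close>.

  It remains to see that \<open>\<nu>\<^sub>\<CC>(g)\<close> is the least of the values \<open>\<nu>\<^sub>\<DD>(g)\<close> over all maximal chains \<open>\<DD>\<close>
  (\<open>lex_compare_coordinates\<close>). Let \<open>\<rho>\<close> be
  the largest face in which \<open>v = \<nu>\<^sub>\<CC>(g)\<close> and \<open>w = \<nu>\<^sub>\<DD>(g)\<close> differ, and let \<open>D\<close> consist of the members of \<open>\<DD>\<close>
  below \<open>\<rho>\<close> in the total order; none of them contains \<open>\<rho>\<close>. The linear form for \<open>D\<close> and \<open>\<rho>\<close> is applied
  to the difference of the two expansions of \<open>-\<lambda>\<^sub>g\<close>. Faces above \<open>\<rho>\<close> cancel, those of \<open>D\<close> contribute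
  \<open>0\<close>, and the other ones have a coefficient from \<open>v\<close> alone, so they contribute something nonnegative since
  \<open>v \<ge> 0\<close>. The contribution of \<open>\<rho>\<close> must therefore be at most \<open>0\<close>, which forces \<open>v \<rho> < w \<rho>\<close>.

  That an eigenfunction is its own only weight component, so that \<open>\<nu>\<^sub>\<CC>(g)\<close> really is a single coordinate
  vector, is the linear independence of distinct characters (\<open>ext_characters_independent\<close>).
\<close>

section \<open>Chains of faces of a polytope\<close>

text \<open>
  Every face of a polytope is exposed. If \<open>\<tau>\<close> is the largest member of \<open>D\<close> and \<open>a \<bullet> x \<le> b\<close> on \<open>P\<close> with
  equality exactly on \<open>\<tau>\<close>, then the homogenisation \<open>(h, x) \<mapsto> b h - a \<bullet> x\<close> does the job. For empty \<open>D\<close> the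
  height \<open>(h, x) \<mapsto> h\<close> takes its place.
\<close>

lemma supporting_functional:
  fixes P :: "(real ^ 'n) set"
  assumes P: "polytope P" and \<rho>: "\<rho> \<in> faces P"
    and D: "D \<subseteq> faces P" "finite D" "\<And>\<sigma> \<tau>. \<sigma> \<in> D \<Longrightarrow> \<tau> \<in> D \<Longrightarrow> \<sigma> \<subseteq> \<tau> \<or> \<tau> \<subseteq> \<sigma>"
    and not_above: "\<And>\<tau>. \<tau> \<in> D \<Longrightarrow> \<not> \<rho> \<subseteq> \<tau>"
  obtains n :: "real \<times> (real ^ 'n)"
  where "\<And>x. x \<in> P \<Longrightarrow> 0 \<le> n \<bullet> (1, x)"
    and "\<And>\<tau> x. \<tau> \<in> D \<Longrightarrow> x \<in> \<tau> \<Longrightarrow> n \<bullet> (1, x) = 0"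
    and "\<And>x. x \<in> rel_interior \<rho> \<Longrightarrow> 0 < n \<bullet> (1, x)"
proof (cases "D = {}")
  case True
  show ?thesis
    by (rule that[of "(1, 0)"]) (use True in auto)
next
  case False
  obtain \<tau> where \<tau>: "\<tau> \<in> D" and max: "\<And>\<sigma>. \<sigma> \<in> D \<Longrightarrow> \<tau> \<subseteq> \<sigma> \<Longrightarrow> \<tau> = \<sigma>"
    using finite_has_maximal[OF D(2) False] by auto
  have top: "\<sigma> \<subseteq> \<tau>" if "\<sigma> \<in> D" for \<sigma>
    using D(3)[OF that \<tau>] max[OF that] by blast
  have "\<tau> face_of P"
    using \<tau> D(1) by (auto simp: faces_def)
  then have "\<tau> exposed_face_of P"
    using exposed_face_of_polyhedron polytope_imp_polyhedron P by blast
  then obtain a b where ab: "P \<subseteq> {x. a \<bullet> x \<le> b}" "\<tau> = P \<inter> {x. a \<bullet> x = b}"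
    unfolding exposed_face_of_def by auto
  have \<rho>P: "\<rho> \<subseteq> P"
    using \<rho> face_of_imp_subset by (auto simp: faces_def)
  show ?thesis
  proof (rule that[of "(b, - a)"])
    show "0 \<le> (b, - a) \<bullet> (1, x)" if "x \<in> P" for x
      using that ab by auto
    show "(b, - a) \<bullet> (1, x) = 0" if "\<sigma> \<in> D" "x \<in> \<sigma>" for \<sigma> x
    proof -
      have "x \<in> \<tau>" using top that by auto
      then show ?thesis using ab by auto
    qed
    show "0 < (b, - a) \<bullet> (1, x)" if "x \<in> rel_interior \<rho>" for x
    proof -
      have "x \<notin> \<tau>"
        using subset_of_face_of[OF \<open>\<tau> face_of P\<close> \<rho>P] not_above[OF \<tau>] that by auto
      moreover have "x \<in> P"
        using that \<rho>P rel_interior_subset by blast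
      ultimately have "a \<bullet> x \<noteq> b" "a \<bullet> x \<le> b"
        using ab by auto
      then show ?thesis by auto
    qed
  qed
qed

lemma inner_face_point:
  assumes "q \<in> {1} \<times> rel_interior \<tau>" and "\<And>x. x \<in> \<tau> \<Longrightarrow> R (n \<bullet> (1::real, x))"
  shows "R (n \<bullet> q)"
  using assms rel_interior_subset by (cases q) auto

text \<open>
  The matrix of values of the linear forms of \<open>supporting_functional\<close> at the points \<open>q \<sigma>\<close> is triangular
  with nonzero diagonal along the chain: the form used here isolates the coefficient of the largest
  face with a nonzero coefficient.
\<close>

lemma chain_independent:
  fixes P :: "(real ^ 'n) set" and q :: "(real ^ 'n) set \<Rightarrow> real \<times> (real ^ 'n)"
  assumes P: "polytope P"
    and C: "C \<subseteq> faces P" "finite C" "\<And>\<sigma> \<tau>. \<sigma> \<in> C \<Longrightarrow> \<tau> \<in> C \<Longrightarrow> \<sigma> \<subseteq> \<tau> \<or> \<tau> \<subseteq> \<sigma>"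
    and q: "\<And>\<sigma>. \<sigma> \<in> faces P \<Longrightarrow> q \<sigma> \<in> {1} \<times> rel_interior \<sigma>"
    and zero: "(\<Sum>\<sigma>\<in>C. c \<sigma> *\<^sub>R q \<sigma>) = 0" and mem: "\<sigma> \<in> C"
  shows "c \<sigma> = 0"
proof (rule ccontr)
  assume "c \<sigma> \<noteq> 0"
  then have "finite {\<sigma> \<in> C. c \<sigma> \<noteq> 0}" "{\<sigma> \<in> C. c \<sigma> \<noteq> 0} \<noteq> {}"
    using C(2) mem by auto
  then obtain \<rho> where "\<rho> \<in> {\<sigma> \<in> C. c \<sigma> \<noteq> 0}"
    and max: "\<And>\<tau>. \<tau> \<in> {\<sigma> \<in> C. c \<sigma> \<noteq> 0} \<Longrightarrow> \<rho> \<subseteq> \<tau> \<Longrightarrow> \<rho> = \<tau>"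
    using finite_has_maximal[of "{\<sigma> \<in> C. c \<sigma> \<noteq> 0}"] by auto
  then have \<rho>: "\<rho> \<in> C" "c \<rho> \<noteq> 0"
    by auto
  define D where "D = {\<tau> \<in> C. c \<tau> \<noteq> 0 \<and> \<tau> \<noteq> \<rho>}"
  obtain n :: "real \<times> (real ^ 'n)" where n: "\<And>x. x \<in> P \<Longrightarrow> 0 \<le> n \<bullet> (1, x)"
      "\<And>\<tau> x. \<tau> \<in> D \<Longrightarrow> x \<in> \<tau> \<Longrightarrow> n \<bullet> (1, x) = 0"
      "\<And>x. x \<in> rel_interior \<rho> \<Longrightarrow> 0 < n \<bullet> (1, x)"
  proof (rule supporting_functional[OF P, of \<rho> D])
    show "\<rho> \<in> faces P" "D \<subseteq> faces P" "finite D"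
      using C \<rho> by (auto simp: D_def)
    show "\<not> \<rho> \<subseteq> \<tau>" if "\<tau> \<in> D" for \<tau>
      using that max by (auto simp: D_def)
    show "\<sigma> \<subseteq> \<tau> \<or> \<tau> \<subseteq> \<sigma>" if "\<sigma> \<in> D" "\<tau> \<in> D" for \<sigma> \<tau>
      using that C(3) by (auto simp: D_def)
  qed blast
  have off: "c \<tau> * (n \<bullet> q \<tau>) = 0" if "\<tau> \<in> C - {\<rho>}" for \<tau>
  proof (cases "c \<tau> = 0")
    case False
    then have "\<tau> \<in> D" "\<tau> \<in> faces P"
      using that C(1) by (auto simp: D_def)
    then show ?thesis
      using inner_face_point[OF q, of \<tau> "\<lambda>x. x = 0" n] n(2) by auto
  qed simp
  have "n \<bullet> (\<Sum>\<sigma>\<in>C. c \<sigma> *\<^sub>R q \<sigma>) = (\<Sum>\<sigma>\<in>C. c \<sigma> * (n \<bullet> q \<sigma>))"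
    by (simp add: inner_sum_right)
  also have "\<dots> = c \<rho> * (n \<bullet> q \<rho>)"
    using sum.remove[OF C(2) \<rho>(1), of "\<lambda>\<sigma>. c \<sigma> * (n \<bullet> q \<sigma>)"]
      sum.neutral[of "C - {\<rho>}" "\<lambda>\<sigma>. c \<sigma> * (n \<bullet> q \<sigma>)"] off by simp
  finally have "n \<bullet> q \<rho> = 0"
    using zero \<rho> by simp
  moreover have "0 < n \<bullet> q \<rho>"
    using q[of \<rho>] C(1) \<rho>(1) n(3) by (cases "q \<rho>") auto
  ultimately show False
    by simp
qed

text \<open>
  If \<open>v \<rho>\<close> exceeded \<open>w \<rho>\<close>, the linear form that vanishes on the members of \<open>C\<close> not above \<open>\<rho>\<close> and is positive
  at \<open>q \<rho>\<close> would be positive on the difference of the two expansions, which is zero. The two vectors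
  enter asymmetrically: nonnegativity of \<open>v\<close> controls the faces outside \<open>C\<close>, and the support of
  \<open>w\<close>, being a chain, is what a single supporting form can annihilate.
\<close>

lemma lex_compare_coordinates:
  fixes P :: "(real ^ 'n) set" and q :: "(real ^ 'n) set \<Rightarrow> real \<times> (real ^ 'n)"
    and v w :: "(real ^ 'n) set \<Rightarrow> real"
  assumes P: "polytope P" and r: "refines_inclusion (faces P) r"
    and q: "\<And>\<sigma>. \<sigma> \<in> faces P \<Longrightarrow> q \<sigma> \<in> {1} \<times> rel_interior \<sigma>"
    and C: "C \<subseteq> faces P" "\<And>\<sigma> \<tau>. \<sigma> \<in> C \<Longrightarrow> \<tau> \<in> C \<Longrightarrow> \<sigma> \<subseteq> \<tau> \<or> \<tau> \<subseteq> \<sigma>"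
    and v: "\<And>\<sigma>. \<sigma> \<in> faces P \<Longrightarrow> 0 \<le> v \<sigma>" and w: "\<And>\<sigma>. \<sigma> \<notin> C \<Longrightarrow> w \<sigma> = 0"
    and eq: "(\<Sum>\<sigma>\<in>faces P. v \<sigma> *\<^sub>R q \<sigma>) = (\<Sum>\<sigma>\<in>faces P. w \<sigma> *\<^sub>R q \<sigma>)"
    and \<rho>: "\<rho> \<in> faces P"
    and above: "\<And>\<tau>. \<tau> \<in> faces P \<Longrightarrow> (\<rho>, \<tau>) \<in> r \<Longrightarrow> \<tau> \<noteq> \<rho> \<Longrightarrow> v \<tau> = w \<tau>"
  shows "v \<rho> \<le> w \<rho>"
proof (rule ccontr)
  assume less: "\<not> v \<rho> \<le> w \<rho>"
  have fin: "finite (faces P)"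
    using finite_polytope_faces[OF P] by (auto simp: faces_def intro: rev_finite_subset)
  define D where "D = {\<tau> \<in> C. (\<rho>, \<tau>) \<notin> r}"
  obtain n :: "real \<times> (real ^ 'n)" where n: "\<And>x. x \<in> P \<Longrightarrow> 0 \<le> n \<bullet> (1, x)"
      "\<And>\<tau> x. \<tau> \<in> D \<Longrightarrow> x \<in> \<tau> \<Longrightarrow> n \<bullet> (1, x) = 0"
      "\<And>x. x \<in> rel_interior \<rho> \<Longrightarrow> 0 < n \<bullet> (1, x)"
  proof (rule supporting_functional[OF P \<rho>, of D])
    show "D \<subseteq> faces P"
      using C by (auto simp: D_def)
    then show "finite D"
      using fin finite_subset by blast
    show "\<not> \<rho> \<subseteq> \<tau>" if "\<tau> \<in> D" for \<tau>
      using that r \<rho> C(1) by (auto simp: D_def refines_inclusion_def)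
    show "\<sigma> \<subseteq> \<tau> \<or> \<tau> \<subseteq> \<sigma>" if "\<sigma> \<in> D" "\<tau> \<in> D" for \<sigma> \<tau>
      using that C(2) by (auto simp: D_def)
  qed blast
  have pos: "0 < (v \<rho> - w \<rho>) * (n \<bullet> q \<rho>)"
    using q[OF \<rho>] n(3) less by (cases "q \<rho>") auto
  have nonneg: "0 \<le> (v \<tau> - w \<tau>) * (n \<bullet> q \<tau>)" if \<tau>: "\<tau> \<in> faces P" for \<tau>
  proof -
    consider "\<tau> = \<rho>" | "\<tau> \<noteq> \<rho>" "(\<rho>, \<tau>) \<in> r" | "\<tau> \<in> D" | "\<tau> \<notin> C"
      by (auto simp: D_def)
    then show ?thesis
    proof cases
      case 1 then show ?thesis using pos by simp
    next
      case 2 then show ?thesis using above[OF \<tau>] by simp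
    next
      case 3 then show ?thesis
        using inner_face_point[OF q[OF \<tau>], of "\<lambda>x. x = 0" n] n(2) by auto
    next
      case 4
      have "\<tau> \<subseteq> P" using \<tau> face_of_imp_subset by (auto simp: faces_def)
      then have "0 \<le> n \<bullet> q \<tau>"
        using inner_face_point[OF q[OF \<tau>], of "\<lambda>x. 0 \<le> x" n] n(1) by auto
      then show ?thesis using v[OF \<tau>] w[OF 4] by simp
    qed
  qed
  have "0 < (\<Sum>\<tau>\<in>faces P. (v \<tau> - w \<tau>) * (n \<bullet> q \<tau>))"
    by (rule sum_pos2[OF fin \<rho>]) (use pos nonneg in auto)
  also have "\<dots> = n \<bullet> ((\<Sum>\<sigma>\<in>faces P. v \<sigma> *\<^sub>R q \<sigma>) - (\<Sum>\<sigma>\<in>faces P. w \<sigma> *\<^sub>R q \<sigma>))"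
    by (simp add: inner_sum_right inner_diff_right sum_subtractf algebra_simps)
  finally show False
    using eq by simp
qed

lemma maximal_chainD:
  assumes "C \<in> maximal_chains A"
  shows "C \<subseteq> A" and "\<And>\<sigma> \<tau>. \<sigma> \<in> C \<Longrightarrow> \<tau> \<in> C \<Longrightarrow> \<sigma> \<subseteq> \<tau> \<or> \<tau> \<subseteq> \<sigma>"
    and "\<And>\<rho>. \<rho> \<in> A \<Longrightarrow> (\<And>\<sigma>. \<sigma> \<in> C \<Longrightarrow> \<sigma> \<subseteq> \<rho> \<or> \<rho> \<subseteq> \<sigma>) \<Longrightarrow> \<rho> \<in> C"
proof -
  have max: "subset.maxchain A C"
    using assms by (simp add: maximal_chains_def)
  then have chain: "subset.chain A C"
    by (simp add: subset.maxchain_def)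
  then show "C \<subseteq> A" and "\<And>\<sigma> \<tau>. \<sigma> \<in> C \<Longrightarrow> \<tau> \<in> C \<Longrightarrow> \<sigma> \<subseteq> \<tau> \<or> \<tau> \<subseteq> \<sigma>"
    unfolding subset.chain_def by auto
  show "\<rho> \<in> C" if "\<rho> \<in> A" "\<And>\<sigma>. \<sigma> \<in> C \<Longrightarrow> \<sigma> \<subseteq> \<rho> \<or> \<rho> \<subseteq> \<sigma>" for \<rho>
  proof (rule ccontr)
    assume "\<rho> \<notin> C"
    have "subset.chain A (insert \<rho> C)"
      using chain that unfolding subset_chain_insert by blast
    then show False
      using max \<open>\<rho> \<notin> C\<close> unfolding subset.maxchain_def by blast
  qed
qed

text \<open>
  Dimension is strictly increasing along a chain of faces, and by maximality it takes every value from
  \<open>0\<close> to \<open>d\<close>. If \<open>k\<close> were left out, let \<open>G\<close> be the smallest member of dimension above \<open>k\<close>. A facet \<open>H\<close> of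
  \<open>G\<close> through the largest member of dimension below \<open>k\<close> is comparable to the whole chain, hence belongs to
  it; but its dimension is at least \<open>k\<close>, so it contradicts the choice of \<open>G\<close>.
\<close>

lemma card_maximal_chain_faces:
  fixes P :: "(real ^ 'n) set"
  assumes P: "polytope P" and dim: "aff_dim P = int d" and C: "C \<in> maximal_chains (faces P)"
  shows "card C = Suc d"
proof -
  note CA = maximal_chainD(1)[OF C] and Cchain = maximal_chainD(2)[OF C]
    and Cmax = maximal_chainD(3)[OF C]
  have fin: "finite C"
    using finite_subset[OF CA] finite_polytope_faces[OF P]
    by (auto simp: faces_def intro: rev_finite_subset)
  have face: "\<sigma> face_of P" "\<sigma> \<noteq> {}" "\<sigma> \<subseteq> P" "polytope \<sigma>" "convex \<sigma>" if "\<sigma> \<in> C" for \<sigma>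
  proof -
    show "\<sigma> face_of P" "\<sigma> \<noteq> {}"
      using that CA by (auto simp: faces_def)
    then show "\<sigma> \<subseteq> P" "polytope \<sigma>"
      using face_of_imp_subset face_of_polytope_polytope[OF P] by auto
    then show "convex \<sigma>"
      by (simp add: polytope_imp_convex)
  qed
  have mono: "aff_dim \<sigma> < aff_dim \<tau>" if "\<sigma> \<in> C" "\<tau> \<in> C" "\<sigma> \<subset> \<tau>" for \<sigma> \<tau>
    using that face_of_aff_dim_lt[of \<tau> \<sigma>] face face_of_subset[of \<sigma> P \<tau>] by auto
  have inj: "inj_on aff_dim C"
  proof (rule inj_onI)
    fix \<sigma> \<tau> assume "\<sigma> \<in> C" "\<tau> \<in> C" "aff_dim \<sigma> = aff_dim \<tau>"
    then show "\<sigma> = \<tau>"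
      using mono[of \<sigma> \<tau>] mono[of \<tau> \<sigma>] Cchain[of \<sigma> \<tau>] by auto
  qed
  have "P \<noteq> {}"
    using dim by auto
  then have "P \<in> C"
    using face(3) by (intro Cmax) (auto simp: faces_def P polytope_imp_convex face_of_refl)
  have image: "aff_dim ` C = int ` {0..d}"
  proof (intro set_eqI iffI)
    fix k assume "k \<in> aff_dim ` C"
    then obtain \<sigma> where \<sigma>: "\<sigma> \<in> C" "k = aff_dim \<sigma>" by auto
    have "0 \<le> k"
      using face(2)[OF \<sigma>(1)] \<sigma>(2) aff_dim_empty[of \<sigma>] aff_dim_geq[of \<sigma>] by linarith
    moreover have "k \<le> int d"
      using aff_dim_subset[OF face(3)[OF \<sigma>(1)]] dim \<sigma>(2) by simp
    ultimately show "k \<in> int ` {0..d}"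
      by (auto simp: image_iff intro: bexI[of _ "nat k"])
  next
    fix k assume "k \<in> int ` {0..d}"
    then have k: "0 \<le> k" "k \<le> int d" by auto
    show "k \<in> aff_dim ` C"
    proof (rule ccontr)
      assume missing: "k \<notin> aff_dim ` C"
      define U where "U = {\<sigma> \<in> C. k < aff_dim \<sigma>}"
      define L where "L = {\<sigma> \<in> C. aff_dim \<sigma> < k}"
      have CUL: "C = U \<union> L"
        using missing by (force simp: U_def L_def)
      have "P \<in> U"
        using k dim missing \<open>P \<in> C\<close> by (force simp: U_def)
      then obtain G where G: "G \<in> U" and Gmin: "\<And>\<sigma>. \<sigma> \<in> U \<Longrightarrow> \<sigma> \<subseteq> G \<Longrightarrow> G = \<sigma>"
        using finite_has_minimal[of U] fin by (auto simp: U_def)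
      have GC: "G \<in> C" "k < aff_dim G"
        using G by (auto simp: U_def)
      have GU: "G \<subseteq> \<sigma>" if "\<sigma> \<in> U" for \<sigma>
        using Cchain[of G \<sigma>] Gmin[OF that] that GC by (auto simp: U_def)
      \<comment> \<open>A proper nonempty face of \<open>G\<close> through which the facet is laid; any vertex serves if no
        member of the chain has dimension below \<open>k\<close>.\<close>
      obtain E where E: "E face_of G" "E \<noteq> {}" "E \<noteq> G" "\<And>\<sigma>. \<sigma> \<in> L \<Longrightarrow> \<sigma> \<subseteq> E"
      proof (cases "L = {}")
        case True
        obtain x where "x extreme_point_of G"
          using extreme_point_exists_convex[of G] face[OF GC(1)] polytope_imp_compact by blast
        then have "{x} face_of G"
          by (simp add: face_of_singleton)
        moreover have "{x} \<noteq> G"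
          using GC(2) k(1) by auto
        ultimately show ?thesis
          using that[of "{x}"] True by auto
      next
        case False
        then obtain F where F: "F \<in> L" and Fmax: "\<And>\<sigma>. \<sigma> \<in> L \<Longrightarrow> F \<subseteq> \<sigma> \<Longrightarrow> F = \<sigma>"
          using finite_has_maximal[of L] fin by (auto simp: L_def)
        have FC: "F \<in> C" "aff_dim F < k"
          using F by (auto simp: L_def)
        have FG: "F \<subseteq> G" "F \<noteq> G"
          using Cchain[OF FC(1) GC(1)] mono[OF GC(1) FC(1)] FC GC by auto
        show ?thesis
        proof (rule that[of F])
          show "F face_of G"
            using face_of_subset[OF face(1)[OF FC(1)] FG(1) face(3)[OF GC(1)]] .
          show "F \<noteq> {}" "F \<noteq> G"
            using face FC FG by auto
          show "\<sigma> \<subseteq> F" if "\<sigma> \<in> L" for \<sigma>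
            using Cchain[of F \<sigma>] Fmax[OF that] that FC by (auto simp: L_def)
        qed
      qed
      obtain H where H: "H facet_of G" "E \<subseteq> H"
        using face_of_polyhedron_subset_facet[OF polytope_imp_polyhedron[OF face(4)[OF GC(1)]] E(1-3)]
        by blast
      have H': "H face_of G" "H \<noteq> {}" "aff_dim H = aff_dim G - 1"
        using H(1) by (auto simp: facet_of_def)
      have "H \<in> C"
      proof (rule Cmax)
        show "H \<in> faces P"
          using face_of_trans[OF H'(1) face(1)[OF GC(1)]] H'(2) by (simp add: faces_def)
        show "\<sigma> \<subseteq> H \<or> H \<subseteq> \<sigma>" if "\<sigma> \<in> C" for \<sigma>
          using that CUL GU E(4) H(2) face_of_imp_subset[OF H'(1)] by blast
      qed
      moreover have "H \<notin> U"
        using Gmin[of H] face_of_imp_subset[OF H'(1)] H'(3) by auto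
      moreover have "H \<notin> L"
        using H'(3) GC(2) by (auto simp: L_def)
      ultimately show False
        using CUL by auto
    qed
  qed
  have "card C = card (aff_dim ` C)"
    using card_image[OF inj] by simp
  also have "\<dots> = Suc d"
    unfolding image by (simp add: card_image)
  finally show ?thesis .
qed


section \<open>Rational coordinates of lattice vectors\<close>

definition real_weight :: "int \<times> (int ^ 'n) \<Rightarrow> real \<times> (real ^ 'n)"
  where "real_weight l = (of_int (fst l), to_real (snd l))"

text \<open>
  The index type \<open>'n option\<close> makes \<open>\<rat> \<oplus> \<rat>\<^sup>n\<close> a space of column vectors over a field, so that
  the dimension theory of \<^typ>\<open>rat ^ 'n option\<close> applies.
\<close>

definition rat_weight :: "int \<times> (int ^ 'n) \<Rightarrow> rat ^ ('n option)"
  where "rat_weight l = (\<chi> i. case i of None \<Rightarrow> of_int (fst l) | Some j \<Rightarrow> of_int (snd l $ j))"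

lemma rat_weight_eq_iff:
  fixes w :: "'a \<Rightarrow> int \<times> (int ^ 'n)"
  shows "rat_weight l = (\<Sum>\<sigma>\<in>C. a \<sigma> *s rat_weight (w \<sigma>)) \<longleftrightarrow>
    of_int (fst l) = (\<Sum>\<sigma>\<in>C. a \<sigma> * of_int (fst (w \<sigma>))) \<and>
    (\<forall>i. of_int (snd l $ i) = (\<Sum>\<sigma>\<in>C. a \<sigma> * of_int (snd (w \<sigma>) $ i)))"
proof -
  have option_all: "(\<forall>i. Q i) \<longleftrightarrow> Q None \<and> (\<forall>j. Q (Some j))" for Q :: "'n option \<Rightarrow> bool"
    by (metis option.exhaust)
  show ?thesis
    unfolding vec_eq_iff option_all by (simp add: rat_weight_def)
qed

lemma real_weight_eq_sum:
  assumes "rat_weight l = (\<Sum>\<sigma>\<in>C. a \<sigma> *s rat_weight (w \<sigma>))"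
  shows "real_weight l = (\<Sum>\<sigma>\<in>C. real_of_rat (a \<sigma>) *\<^sub>R real_weight (w \<sigma>))"
proof -
  note eqs = assms[unfolded rat_weight_eq_iff]
  have "real_of_int (fst l) = (\<Sum>\<sigma>\<in>C. real_of_rat (a \<sigma>) * of_int (fst (w \<sigma>)))"
    using arg_cong[OF conjunct1[OF eqs], of real_of_rat] by (simp add: of_rat_sum of_rat_mult)
  moreover have "real_of_int (snd l $ i) = (\<Sum>\<sigma>\<in>C. real_of_rat (a \<sigma>) * of_int (snd (w \<sigma>) $ i))" for i
    using arg_cong[OF spec[OF conjunct2[OF eqs], of i], of real_of_rat]
    by (simp add: of_rat_sum of_rat_mult)
  ultimately show ?thesis
    by (simp add: real_weight_def to_real_def prod_eq_iff fst_sum snd_sum vec_eq_iff)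
qed

text \<open>
  A rational relation is in particular a real one, so \<open>n + 1\<close> integral vectors that are independent over
  the reals are a basis over the rationals.
\<close>

lemma rational_coordinates:
  fixes w :: "'a \<Rightarrow> int \<times> (int ^ 'n)"
  assumes fin: "finite C" and card: "card C = Suc CARD('n)"
    and indep: "\<And>c. (\<Sum>\<sigma>\<in>C. c \<sigma> *\<^sub>R real_weight (w \<sigma>)) = 0 \<Longrightarrow> \<forall>\<sigma>\<in>C. c \<sigma> = 0"
  shows "\<exists>!a. (\<forall>\<sigma>. \<sigma> \<notin> C \<longrightarrow> a \<sigma> = 0) \<and> rat_weight l = (\<Sum>\<sigma>\<in>C. a \<sigma> *s rat_weight (w \<sigma>))"
proof -
  let ?e = "\<lambda>\<sigma>. rat_weight (w \<sigma>)"
  have indep_rat: "\<forall>\<sigma>\<in>C. c \<sigma> = 0" if "(\<Sum>\<sigma>\<in>C. c \<sigma> *s ?e \<sigma>) = 0" for c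
  proof -
    have "rat_weight 0 = (\<Sum>\<sigma>\<in>C. c \<sigma> *s ?e \<sigma>)"
      using that by (simp add: rat_weight_def vec_eq_iff split: option.split)
    then have "(\<Sum>\<sigma>\<in>C. real_of_rat (c \<sigma>) *\<^sub>R real_weight (w \<sigma>)) = real_weight 0"
      by (rule real_weight_eq_sum[symmetric])
    also have "real_weight 0 = (0 :: real \<times> (real ^ 'n))"
      by (simp add: real_weight_def to_real_def vec_eq_iff prod_eq_iff)
    finally show ?thesis
      using indep by fastforce
  qed
  have inj: "inj_on ?e C"
  proof (rule inj_onI, rule ccontr)
    fix \<sigma> \<tau> assume *: "\<sigma> \<in> C" "\<tau> \<in> C" "?e \<sigma> = ?e \<tau>" "\<sigma> \<noteq> \<tau>"
    \<comment> \<open>Equal vectors at distinct indices give the nontrivial relation \<open>e\<^sub>\<sigma> - e\<^sub>\<tau> = 0\<close>.\<close>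
    define c :: "'a \<Rightarrow> rat" where "c \<rho> = (if \<rho> = \<sigma> then 1 else 0) - (if \<rho> = \<tau> then 1 else 0)" for \<rho>
    have "(\<Sum>\<rho>\<in>C. c \<rho> *s ?e \<rho>) =
        (\<Sum>\<rho>\<in>C. if \<rho> = \<sigma> then ?e \<rho> else 0) - (\<Sum>\<rho>\<in>C. if \<rho> = \<tau> then ?e \<rho> else 0)"
      unfolding sum_subtractf[symmetric] by (rule sum.cong) (auto simp: c_def)
    also have "\<dots> = 0"
      using fin * by simp
    finally have "c \<sigma> = 0"
      using indep_rat * by blast
    then show False
      using * by (simp add: c_def)
  qed
  have "vec.independent (?e ` C)"
    unfolding vec.independent_explicit_finite_subsets
  proof (intro allI impI ballI)
    fix A u x assume A: "A \<subseteq> ?e ` C" "finite A" "(\<Sum>v\<in>A. u v *s v) = 0" "x \<in> A"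
    have "(\<Sum>\<sigma>\<in>C. (if ?e \<sigma> \<in> A then u (?e \<sigma>) else 0) *s ?e \<sigma>)
        = (\<Sum>v\<in>?e ` C. (if v \<in> A then u v else 0) *s v)"
      by (simp add: sum.reindex[OF inj])
    also have "\<dots> = (\<Sum>v\<in>A. u v *s v)"
      by (rule sum.mono_neutral_cong_right) (use A fin in auto)
    finally have "\<forall>\<sigma>\<in>C. (if ?e \<sigma> \<in> A then u (?e \<sigma>) else 0) = 0"
      using A(3) by (intro indep_rat) simp
    then show "u x = 0"
      using A by force
  qed
  moreover have "vec.dim (UNIV :: (rat ^ 'n option) set) = card (?e ` C)"
    unfolding vec_dim_card using card by (simp add: card_image[OF inj] card_UNIV_option)
  ultimately have "UNIV \<subseteq> vec.span (?e ` C)"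
    using vec.card_ge_dim_independent[of "?e ` C" UNIV] by simp
  then have "rat_weight l \<in> vec.span (?e ` C)"
    by blast
  then obtain u where "rat_weight l = (\<Sum>v\<in>?e ` C. u v *s v)"
    using fin by (auto simp: vec.span_finite)
  then have u: "rat_weight l = (\<Sum>\<sigma>\<in>C. u (?e \<sigma>) *s ?e \<sigma>)"
    by (simp add: sum.reindex[OF inj])
  show ?thesis
  proof (rule ex1I[of _ "\<lambda>\<sigma>. if \<sigma> \<in> C then u (?e \<sigma>) else 0"])
    show "(\<forall>\<sigma>. \<sigma> \<notin> C \<longrightarrow> (if \<sigma> \<in> C then u (?e \<sigma>) else 0) = 0) \<and>
        rat_weight l = (\<Sum>\<sigma>\<in>C. (if \<sigma> \<in> C then u (?e \<sigma>) else 0) *s ?e \<sigma>)"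
      unfolding u by (auto intro: sum.cong)
  next
    fix a assume a: "(\<forall>\<sigma>. \<sigma> \<notin> C \<longrightarrow> a \<sigma> = 0) \<and> rat_weight l = (\<Sum>\<sigma>\<in>C. a \<sigma> *s ?e \<sigma>)"
    then have "(\<Sum>\<sigma>\<in>C. (a \<sigma> - u (?e \<sigma>)) *s ?e \<sigma>) = 0"
      using u by (simp add: vec.scale_left_diff_distrib sum_subtractf)
    then have "\<forall>\<sigma>\<in>C. a \<sigma> = u (?e \<sigma>)"
      using indep_rat by fastforce
    then show "a = (\<lambda>\<sigma>. if \<sigma> \<in> C then u (?e \<sigma>) else 0)"
      using a by auto
  qed
qed

lemma eigen_val_coordinates:
  fixes P :: "(real ^ 'n) set" and f :: "(real ^ 'n) set \<Rightarrow> ('n, 'k::field) pfun"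
  assumes "finite C" and "card C = Suc CARD('n)"
    and "\<And>c. (\<Sum>\<sigma>\<in>C. c \<sigma> *\<^sub>R real_weight (weight P (f \<sigma>))) = 0 \<Longrightarrow> \<forall>\<sigma>\<in>C. c \<sigma> = 0"
  shows "\<And>\<sigma>. \<sigma> \<notin> C \<Longrightarrow> eigen_val P f C g \<sigma> = 0"
    and "real_weight (weight P g) =
      (\<Sum>\<sigma>\<in>C. real_of_rat (eigen_val P f C g \<sigma>) *\<^sub>R real_weight (weight P (f \<sigma>)))"
proof -
  note ex = rational_coordinates[OF assms, where l = "weight P g"]
  have coord: "(\<forall>\<sigma>. \<sigma> \<notin> C \<longrightarrow> eigen_val P f C g \<sigma> = 0) \<and> rat_weight (weight P g) =
      (\<Sum>\<sigma>\<in>C. eigen_val P f C g \<sigma> *s rat_weight (weight P (f \<sigma>)))"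
    using theI'[OF ex] unfolding eigen_val_def rat_weight_eq_iff .
  then show "\<And>\<sigma>. \<sigma> \<notin> C \<Longrightarrow> eigen_val P f C g \<sigma> = 0"
    by blast
  show "real_weight (weight P g) =
      (\<Sum>\<sigma>\<in>C. real_of_rat (eigen_val P f C g \<sigma>) *\<^sub>R real_weight (weight P (f \<sigma>)))"
    by (rule real_weight_eq_sum[OF conjunct2[OF coord]])
qed


section \<open>Weight components of an eigenfunction\<close>

definition ext_mult :: "'k::field \<times> ('k ^ 'n) \<Rightarrow> 'k \<times> ('k ^ 'n) \<Rightarrow> 'k \<times> ('k ^ 'n)"
  where "ext_mult s t = (fst s * fst t, \<chi> i. snd s $ i * snd t $ i)"

lemma ext_mult_in_ext_torus: "s \<in> ext_torus \<Longrightarrow> t \<in> ext_torus \<Longrightarrow> ext_mult s t \<in> ext_torus"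
  by (auto simp: ext_torus_def torus_def ext_mult_def)

lemma ext_character_mult: "ext_character l (ext_mult s t) = ext_character l s * ext_character l t"
  by (simp add: ext_character_def character_def ext_mult_def power_int_mult_distrib
      prod.distrib)

lemma ext_character_nonzero: "s \<in> ext_torus \<Longrightarrow> ext_character l s \<noteq> 0"
  by (auto simp: ext_character_def character_def ext_torus_def torus_def)

text \<open>In characteristic zero \<open>2\<close> has infinite order, so it tells all exponents of a character apart.\<close>

lemma two_powi_inject:
  assumes "(2 :: 'k::field_char_0) powi a = 2 powi b"
  shows "a = b"
proof -
  have pow: "n = 0" if "(2 :: 'k) ^ n = 1" for n
  proof -
    have "(of_nat (2 ^ n) :: 'k) = of_nat 1"
      using that by simp
    then have "2 ^ n = (1 :: nat)"
      by (simp only: of_nat_eq_iff)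
    then show ?thesis
      by simp
  qed
  have "(2 :: 'k) powi (a - b) = 1" "(2 :: 'k) powi (b - a) = 1"
    using assms by (simp_all add: power_int_diff)
  then have "(2 :: 'k) ^ nat (a - b) = 1" "(2 :: 'k) ^ nat (b - a) = 1"
    by (cases "a \<le> b"; simp add: power_int_def)+
  then have "nat (a - b) = 0" "nat (b - a) = 0"
    using pow by blast+
  then show ?thesis
    by simp
qed

lemma ext_characters_separated:
  fixes l l' :: "int \<times> (int ^ 'n)"
  assumes "l \<noteq> l'"
  obtains s :: "'k::field_char_0 \<times> ('k ^ 'n)" where "s \<in> ext_torus" "ext_character l s \<noteq> ext_character l' s"
proof (cases "fst l = fst l'")
  case False
  show ?thesis
    by (rule that[of "(2, \<chi> i. 1)"])
      (use False two_powi_inject in \<open>auto simp: ext_torus_def torus_def ext_character_def character_def\<close>)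
next
  case True
  with assms obtain i where i: "snd l $ i \<noteq> snd l' $ i"
    by (auto simp: prod_eq_iff vec_eq_iff)
  have char: "character u (\<chi> j. if j = i then 2 else (1 :: 'k)) = 2 powi (u $ i)" for u :: "int ^ 'n"
  proof -
    have "character u (\<chi> j. if j = i then 2 else (1 :: 'k)) = (\<Prod>j\<in>UNIV. if j = i then 2 powi (u $ j) else 1)"
      unfolding character_def by (rule prod.cong) auto
    then show ?thesis by simp
  qed
  show ?thesis
    by (rule that[of "(1, \<chi> j. if j = i then 2 else 1)"])
      (use i two_powi_inject in \<open>auto simp: ext_torus_def torus_def ext_character_def char\<close>)
qed

text \<open>
  Dedekind's argument: translating a relation by \<open>s0\<close> and subtracting \<open>m(s0)\<close> times the original one
  removes the character \<open>m\<close>, and multiplies the coefficient of \<open>l\<close> by \<open>l(s0) - m(s0) \<noteq> 0\<close>.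
\<close>

lemma ext_characters_independent:
  fixes c :: "int \<times> (int ^ 'n) \<Rightarrow> 'k::field_char_0"
  assumes "finite L" and "\<And>s. s \<in> ext_torus \<Longrightarrow> (\<Sum>l\<in>L. c l * ext_character l s) = 0" and "l \<in> L"
  shows "c l = 0"
  using assms
proof (induction L arbitrary: c l rule: finite_induct)
  case (insert m L)
  have off: "c l = 0" if l: "l \<in> L" for l
  proof -
    obtain s0 :: "'k \<times> ('k ^ 'n)" where s0: "s0 \<in> ext_torus" "ext_character l s0 \<noteq> ext_character m s0"
      using ext_characters_separated[of l m] l insert.hyps by metis
    define c' where "c' k = c k * (ext_character k s0 - ext_character m s0)" for k
    have "(\<Sum>k\<in>L. c' k * ext_character k s) = 0" if s: "s \<in> ext_torus" for s
    proof -
      have "(\<Sum>k\<in>L. c' k * ext_character k s) = (\<Sum>k\<in>insert m L. c' k * ext_character k s)"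
        using insert.hyps by (simp add: c'_def)
      also have "\<dots> = (\<Sum>k\<in>insert m L. c k * ext_character k (ext_mult s0 s))
          - ext_character m s0 * (\<Sum>k\<in>insert m L. c k * ext_character k s)"
        by (simp add: c'_def ext_character_mult sum_distrib_left sum_subtractf[symmetric]
            algebra_simps del: sum.insert)
      also have "\<dots> = 0"
        using insert.prems(1)[OF s] insert.prems(1)[OF ext_mult_in_ext_torus[OF s0(1) s]] by simp
      finally show ?thesis .
    qed
    then have "c' l = 0"
      using insert.IH[of c' l] l by blast
    then show ?thesis
      using s0 by (simp add: c'_def)
  qed
  have one: "(1, \<chi> i. 1) \<in> (ext_torus :: ('k \<times> ('k ^ 'n)) set)"
    by (simp add: ext_torus_def torus_def)
  have "c m * ext_character m (1, \<chi> i. 1) = 0"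
    using insert.prems(1)[OF one] insert.hyps off by simp
  then have "c m = 0"
    using ext_character_nonzero[OF one] by simp
  then show ?case
    using off insert.prems(2) by blast
qed simp

text \<open>
  Evaluating both decompositions along the torus orbit of a fixed vector \<open>v\<close> gives a linear relation
  between characters, with the differences of the components at \<open>v\<close> as coefficients.
\<close>

lemma weight_decomposition_unique:
  fixes h h' :: "int \<times> (int ^ 'n) \<Rightarrow> ('n::finite, 'k::field_char_0) pfun"
  assumes h: "\<And>l. h l \<in> weight_space P l" and fin: "finite {l. h l \<noteq> (\<lambda>_. 0)}"
    and h': "\<And>l. h' l \<in> weight_space P l" and fin': "finite {l. h' l \<noteq> (\<lambda>_. 0)}"
    and eq: "(\<lambda>v. \<Sum>l | h l \<noteq> (\<lambda>_. 0). h l v) = (\<lambda>v. \<Sum>l | h' l \<noteq> (\<lambda>_. 0). h' l v)"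
  shows "h = h'"
proof (intro ext)
  fix l :: "int \<times> (int ^ 'n)" and v :: "('n, 'k) vect"
  define L where "L = {l. h l \<noteq> (\<lambda>_. 0)} \<union> {l. h' l \<noteq> (\<lambda>_. 0)}"
  have L: "finite L"
    using fin fin' by (simp add: L_def)
  have sums: "(\<Sum>l\<in>L. h l u) = (\<Sum>l\<in>L. h' l u)" for u
  proof -
    have "(\<Sum>l\<in>L. h l u) = (\<Sum>l | h l \<noteq> (\<lambda>_. 0). h l u)"
      by (rule sum.mono_neutral_right) (use L in \<open>auto simp: L_def\<close>)
    also have "\<dots> = (\<Sum>l | h' l \<noteq> (\<lambda>_. 0). h' l u)"
      using fun_cong[OF eq] .
    also have "\<dots> = (\<Sum>l\<in>L. h' l u)"
      by (rule sum.mono_neutral_left) (use L in \<open>auto simp: L_def\<close>)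
    finally show ?thesis .
  qed
  have act: "p (act (ext_inverse s) v) = ext_character k s * p v"
    if "p \<in> weight_space P k" "s \<in> ext_torus" for p :: "('n, 'k) pfun" and k s
    using that unfolding weight_space_def fun_act_def by (metis (mono_tags, lifting) mem_Collect_eq)
  have zero: "(\<Sum>k\<in>L. (h k v - h' k v) * ext_character k s) = 0" if s: "s \<in> ext_torus" for s
    using sums[of "act (ext_inverse s) v"]
    by (simp add: act[OF h s] act[OF h' s] algebra_simps sum_subtractf)
  show "h l v = h' l v"
  proof (cases "l \<in> L")
    case True
    then show ?thesis
      using ext_characters_independent[OF L zero] by fastforce
  qed (auto simp: L_def)
qed

lemma zero_in_weight_space: "(\<lambda>_. 0) \<in> weight_space P l"
proof -
  have "(\<lambda>_. 0) \<in> poly_funs (lattice_points P)"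
    unfolding poly_funs_def by (auto intro!: exI[of _ "{}"])
  moreover have "(\<lambda>_. 0) = restrict_fun (toric_cone P) (\<lambda>_. 0)"
    by (auto simp: restrict_fun_def)
  ultimately have "(\<lambda>_. 0) \<in> coord_ring P"
    unfolding coord_ring_def by blast
  then show ?thesis
    by (simp add: weight_space_def fun_act_def)
qed

lemma weight_components_eigenfunction:
  fixes g :: "('n::finite, 'k::field_char_0) pfun"
  assumes g: "g \<in> weight_space P l" "g \<noteq> (\<lambda>_. 0)"
  shows "weight_components P g = (\<lambda>k. if k = l then g else (\<lambda>_. 0))" (is "_ = ?h")
proof -
  have supp: "{k. ?h k \<noteq> (\<lambda>_. 0)} = {l}"
    using g(2) by auto
  have 1: "\<And>k. ?h k \<in> weight_space P k"
    using g zero_in_weight_space by auto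
  have 2: "finite {k. ?h k \<noteq> (\<lambda>_. 0)}"
    unfolding supp by simp
  have 3: "g = (\<lambda>v. \<Sum>k | ?h k \<noteq> (\<lambda>_. 0). ?h k v)"
    unfolding supp by simp
  show ?thesis
    unfolding weight_components_def
  proof (rule the_equality)
    show "(\<forall>k. ?h k \<in> weight_space P k) \<and> finite {k. ?h k \<noteq> (\<lambda>_. 0)} \<and>
        g = (\<lambda>v. \<Sum>k | ?h k \<noteq> (\<lambda>_. 0). ?h k v)"
      using 1 2 3 by blast
  next
    fix h assume h: "(\<forall>k. h k \<in> weight_space P k) \<and> finite {k. h k \<noteq> (\<lambda>_. 0)} \<and>
        g = (\<lambda>v. \<Sum>k | h k \<noteq> (\<lambda>_. 0). h k v)"
    then have "(\<lambda>v. \<Sum>k | h k \<noteq> (\<lambda>_. 0). h k v) = (\<lambda>v. \<Sum>k | ?h k \<noteq> (\<lambda>_. 0). ?h k v)"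
      using 3 by argo
    then show "h = ?h"
      using h by (intro weight_decomposition_unique[OF _ _ 1 2]) blast+
  qed
qed


section \<open>Lexicographic minima\<close>

lemma lex_less_asym:
  assumes "linear_order_on A r" "lex_less A r a b"
  shows "\<not> lex_less A r b a"
proof
  assume "lex_less A r b a"
  then obtain \<tau> where \<tau>: "\<tau> \<in> A" "b \<tau> < a \<tau>" "\<And>\<rho>. \<rho> \<in> A \<Longrightarrow> (\<tau>, \<rho>) \<in> r \<Longrightarrow> \<rho> \<noteq> \<tau> \<Longrightarrow> b \<rho> = a \<rho>"
    unfolding lex_less_def by blast
  obtain \<sigma> where \<sigma>: "\<sigma> \<in> A" "a \<sigma> < b \<sigma>" "\<And>\<rho>. \<rho> \<in> A \<Longrightarrow> (\<sigma>, \<rho>) \<in> r \<Longrightarrow> \<rho> \<noteq> \<sigma> \<Longrightarrow> a \<rho> = b \<rho>"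
    using assms(2) unfolding lex_less_def by blast
  consider "\<sigma> = \<tau>" | "\<sigma> \<noteq> \<tau>" "(\<sigma>, \<tau>) \<in> r" | "\<sigma> \<noteq> \<tau>" "(\<tau>, \<sigma>) \<in> r"
    using assms(1) \<sigma>(1) \<tau>(1) unfolding linear_order_on_def total_on_def by blast
  then show False
    by cases (use \<sigma>(2) \<tau>(2) \<sigma>(3)[OF \<tau>(1)] \<tau>(3)[OF \<sigma>(1)] in auto)
qed

lemma lex_min_eqI:
  assumes "linear_order_on A r" "a \<in> S" "\<And>b. b \<in> S \<Longrightarrow> b = a \<or> lex_less A r a b"
  shows "lex_min A r S = a"
  unfolding lex_min_def
proof (rule the_equality)
  fix b assume "b \<in> S \<and> (\<forall>c\<in>S. c = b \<or> lex_less A r b c)"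
  then show "b = a"
    using assms lex_less_asym by metis
qed (use assms in auto)

lemma finite_linear_order_greatest:
  assumes "linear_order_on A r" "finite B" "B \<noteq> {}" "B \<subseteq> A"
  shows "\<exists>m\<in>B. \<forall>x\<in>B. (x, m) \<in> r"
  using assms(2-4)
proof (induction B rule: finite_ne_induct)
  case (singleton x)
  then show ?case
    using assms(1) by (auto simp: order_on_defs refl_on_def)
next
  case (insert x B)
  then obtain m where m: "m \<in> B" "\<forall>y\<in>B. (y, m) \<in> r"
    by auto
  have r: "refl_on A r" "trans r" "total_on A r"
    using assms(1) by (auto simp: order_on_defs)
  show ?case
  proof (cases "(x, m) \<in> r")
    case True
    then show ?thesis using m by auto
  next
    case False
    then have "(m, x) \<in> r" "(x, x) \<in> r"
      using r insert.prems m(1) unfolding refl_on_def total_on_def by (metis insert_subset subsetD)+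
    then have "\<forall>y\<in>insert x B. (y, x) \<in> r"
      using m(2) r(2) by (auto dest: transD)
    then show ?thesis by blast
  qed
qed

lemma lex_lessI_greatest_difference:
  assumes r: "linear_order_on A r" and A: "finite A"
    and supp: "\<And>\<sigma>. \<sigma> \<notin> A \<Longrightarrow> a \<sigma> = b \<sigma>" and ne: "b \<noteq> a"
    and le: "\<And>\<rho>. \<rho> \<in> A \<Longrightarrow> (\<And>\<tau>. \<tau> \<in> A \<Longrightarrow> (\<rho>, \<tau>) \<in> r \<Longrightarrow> \<tau> \<noteq> \<rho> \<Longrightarrow> a \<tau> = b \<tau>) \<Longrightarrow> a \<rho> \<le> b \<rho>"
  shows "lex_less A r a b"
proof -
  have "finite {\<sigma>\<in>A. a \<sigma> \<noteq> b \<sigma>}" "{\<sigma>\<in>A. a \<sigma> \<noteq> b \<sigma>} \<noteq> {}" "{\<sigma>\<in>A. a \<sigma> \<noteq> b \<sigma>} \<subseteq> A"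
    using A ne supp by (auto simp: fun_eq_iff) metis
  from finite_linear_order_greatest[OF r this] obtain \<rho> where
    \<rho>: "\<rho> \<in> A" "a \<rho> \<noteq> b \<rho>" and greatest: "\<And>\<tau>. \<tau> \<in> A \<Longrightarrow> a \<tau> \<noteq> b \<tau> \<Longrightarrow> (\<tau>, \<rho>) \<in> r"
    by auto
  have above: "a \<tau> = b \<tau>" if "\<tau> \<in> A" "(\<rho>, \<tau>) \<in> r" "\<tau> \<noteq> \<rho>" for \<tau>
    using that greatest[of \<tau>] r unfolding order_on_defs antisym_def by blast
  have "a \<rho> < b \<rho>"
    using le[OF \<rho>(1) above] \<rho>(2) by simp
  then show ?thesis
    unfolding lex_less_def using \<rho>(1) above by blast
qed

lemma chain_val_eigenfunction:
  fixes g :: "('n::finite, 'k::field_char_0) pfun"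
  assumes r: "linear_order_on (faces P) r" and g: "eigenfunction P g"
  shows "chain_val P f r C g = eigen_val P f C g"
proof -
  obtain l where l: "g \<in> weight_space P l" "g \<noteq> (\<lambda>_. 0)"
    using g by (auto simp: eigenfunction_def)
  have "{eigen_val P f C (weight_components P g k) | k. weight_components P g k \<noteq> (\<lambda>_. 0)}
      = {eigen_val P f C g}"
    unfolding weight_components_eigenfunction[OF l] using l(2) by (auto intro!: exI[of _ "fst l"] exI[of _ "snd l"])
  then show ?thesis
    unfolding chain_val_def by (intro lex_min_eqI[OF r]) auto
qed


section \<open>The value of an eigenfunction\<close>

theorem corollary4p6:
  fixes P :: "(real ^ 'n) set"
    and X :: "(real ^ 'n) set \<Rightarrow> ('n, 'k::{alg_closed_field, field_char_0}) vect set set"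
    and f :: "(real ^ 'n) set \<Rightarrow> ('n, 'k) pfun"
    and r :: "(real ^ 'n) set rel"
    and g :: "('n, 'k) pfun"
    and C :: "(real ^ 'n) set set"
    and a :: "(real ^ 'n) set \<Rightarrow> real"
  assumes "lattice_polytope P" and "normal_polytope P" and "aff_dim P = int CARD('n)"
    and "comb_seshadri_stratification P X f"
    and "refines_inclusion (faces P) r"
    and "eigenfunction P g" and "deg P g \<ge> 1"
    and "C \<in> maximal_chains (faces P)"
    and "normalized_weight P g \<in> chain_simplex P f C"
    and "\<forall>\<sigma>\<in>C. a \<sigma> \<ge> 0" and "(\<Sum>\<sigma>\<in>C. a \<sigma>) = 1"
    and "normalized_weight P g = (\<Sum>\<sigma>\<in>C. a \<sigma> *\<^sub>R normalized_weight P (f \<sigma>))"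
  shows "(\<lambda>\<tau>. real_of_rat (quasi_val P f r g \<tau>)) =
    (\<lambda>\<tau>. \<Sum>\<sigma>\<in>C. a \<sigma> * real (deg P g) / real (deg P (f \<sigma>)) * unit_vec \<sigma> \<tau>)"
proof -
  let ?A = "faces P"
  define q where "q \<sigma> = normalized_weight P (f \<sigma>)" for \<sigma>
  define k where "k \<sigma> = real (deg P (f \<sigma>))" for \<sigma>
  have P: "polytope P"
    using assms(1) unfolding lattice_polytope_def polytope_def by blast
  have fin: "finite ?A"
    using finite_polytope_faces[OF P] by (auto simp: faces_def intro: rev_finite_subset)
  have r: "linear_order_on ?A r"
    using assms(5) by (simp add: refines_inclusion_def)
  have q: "q \<sigma> \<in> {1} \<times> rel_interior \<sigma>" and k: "0 < k \<sigma>" if "\<sigma> \<in> ?A" for \<sigma>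
    using assms(4) that unfolding comb_seshadri_stratification_def q_def k_def by fastforce+
  have real_weight_eq: "real_weight (weight P h) = - (real (deg P h) *\<^sub>R normalized_weight P h)"
    if "deg P h \<ge> 1" for h :: "('n, 'k) pfun"
    using that by (simp add: real_weight_def normalized_weight_def)
  have weight_f: "real_weight (weight P (f \<sigma>)) = - (k \<sigma> *\<^sub>R q \<sigma>)" if "\<sigma> \<in> ?A" for \<sigma>
    using real_weight_eq[of "f \<sigma>"] k[OF that] by (simp add: k_def q_def)
  have indep: "\<forall>\<sigma>\<in>C'. c \<sigma> = 0"
    if C': "C' \<in> maximal_chains ?A"
      and zero: "(\<Sum>\<sigma>\<in>C'. c \<sigma> *\<^sub>R real_weight (weight P (f \<sigma>))) = 0" for C' c
  proof
    fix \<sigma> assume \<sigma>: "\<sigma> \<in> C'"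
    note chain = maximal_chainD(1,2)[OF C']
    have "(\<Sum>\<sigma>\<in>C'. (- (c \<sigma> * k \<sigma>)) *\<^sub>R q \<sigma>) = (\<Sum>\<sigma>\<in>C'. c \<sigma> *\<^sub>R real_weight (weight P (f \<sigma>)))"
      by (rule sum.cong) (use chain weight_f in auto)
    then have "- (c \<sigma> * k \<sigma>) = 0"
      using chain_independent[OF P chain(1) finite_subset[OF chain(1) fin] chain(2) q _ \<sigma>,
          of "\<lambda>\<sigma>. - (c \<sigma> * k \<sigma>)"] zero by simp
    then show "c \<sigma> = 0"
      using k \<sigma> chain(1) by force
  qed
  note coordinates = eigen_val_coordinates[OF finite_subset[OF maximal_chainD(1) fin]
      card_maximal_chain_faces[OF P assms(3)] indep]
  have coord: "eigen_val P f C' g \<sigma> = 0" if "\<sigma> \<notin> C'" "C' \<in> maximal_chains ?A" for C' \<sigma>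
    using coordinates(1) that by blast
  have coord_sum: "real_weight (weight P g) =
      (\<Sum>\<sigma>\<in>C'. real_of_rat (eigen_val P f C' g \<sigma>) *\<^sub>R real_weight (weight P (f \<sigma>)))"
    if "C' \<in> maximal_chains ?A" for C'
    by (rule coordinates(2)) (use that in auto)

  \<comment> \<open>The given convex combination is the expansion in the basis of \<open>C\<close>; this also shows that the
    coordinates are nonnegative.\<close>
  let ?v = "eigen_val P f C g"
  note CA = maximal_chainD(1)[OF assms(8)]
  have v_eq: "real_of_rat (?v \<sigma>) = a \<sigma> * real (deg P g) / k \<sigma>" if "\<sigma> \<in> C" for \<sigma>
  proof -
    have "real_weight (weight P g) = - (real (deg P g) *\<^sub>R (\<Sum>\<sigma>\<in>C. a \<sigma> *\<^sub>R q \<sigma>))"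
      using real_weight_eq[OF assms(7)] assms(12) by (simp add: q_def)
    also have "\<dots> = (\<Sum>\<sigma>\<in>C. (a \<sigma> * real (deg P g) / k \<sigma>) *\<^sub>R real_weight (weight P (f \<sigma>)))"
      unfolding scaleR_sum_right sum_negf[symmetric]
    proof (rule sum.cong[OF refl])
      fix \<sigma> assume "\<sigma> \<in> C"
      then show "- (real (deg P g) *\<^sub>R a \<sigma> *\<^sub>R q \<sigma>) =
          (a \<sigma> * real (deg P g) / k \<sigma>) *\<^sub>R real_weight (weight P (f \<sigma>))"
        using CA weight_f[of \<sigma>] k[of \<sigma>] by (auto simp: mult.commute)
    qed
    finally have "(\<Sum>\<sigma>\<in>C. (real_of_rat (?v \<sigma>) - a \<sigma> * real (deg P g) / k \<sigma>)
        *\<^sub>R real_weight (weight P (f \<sigma>))) = 0"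
      using coord_sum[OF assms(8)] by (simp add: scaleR_left_diff_distrib sum_subtractf)
    then show ?thesis
      using indep[OF assms(8)] that by fastforce
  qed
  have v_nonneg: "0 \<le> real_of_rat (?v \<sigma>)" if "\<sigma> \<in> ?A" for \<sigma>
  proof (cases "\<sigma> \<in> C")
    case True
    then show ?thesis using v_eq assms(10) k[OF that] by simp
  next
    case False
    then show ?thesis using coord[OF _ assms(8)] by simp
  qed

  have minimal: "w = ?v \<or> lex_less ?A r ?v w"
    if "w = eigen_val P f C' g" "C' \<in> maximal_chains ?A" for w C'
  proof (cases "w = ?v")
    case False
    note C' = that(2) and C'A = maximal_chainD(1)[OF that(2)]
    \<comment> \<open>With coefficients rescaled by the degrees, both chains expand the same point in the \<open>q \<sigma>\<close>.\<close>
    have total: "(\<Sum>\<sigma>\<in>?A. (real_of_rat (eigen_val P f D g \<sigma>) * k \<sigma>) *\<^sub>R q \<sigma>)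
        = - real_weight (weight P g)" if D: "D \<in> maximal_chains ?A" for D
    proof -
      have DA: "D \<subseteq> ?A" using maximal_chainD(1)[OF D] .
      have "(\<Sum>\<sigma>\<in>?A. (real_of_rat (eigen_val P f D g \<sigma>) * k \<sigma>) *\<^sub>R q \<sigma>)
          = (\<Sum>\<sigma>\<in>D. - (real_of_rat (eigen_val P f D g \<sigma>) *\<^sub>R real_weight (weight P (f \<sigma>))))"
        by (rule sum.mono_neutral_cong_right[OF fin DA]) (use coord[OF _ D] weight_f DA in auto)
      then show ?thesis
        using coord_sum[OF D] by (simp add: sum_negf)
    qed
    have "lex_less ?A r ?v w"
    proof (rule lex_lessI_greatest_difference[OF r fin _ False])
      show "?v \<sigma> = w \<sigma>" if "\<sigma> \<notin> ?A" for \<sigma>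
        using that coord[OF _ assms(8)] coord[OF _ C'] CA C'A \<open>w = _\<close> by (metis subsetD)
    next
      fix \<rho> assume \<rho>: "\<rho> \<in> ?A"
        and above: "\<And>\<tau>. \<tau> \<in> ?A \<Longrightarrow> (\<rho>, \<tau>) \<in> r \<Longrightarrow> \<tau> \<noteq> \<rho> \<Longrightarrow> ?v \<tau> = w \<tau>"
      have "real_of_rat (?v \<rho>) * k \<rho> \<le> real_of_rat (w \<rho>) * k \<rho>"
      proof (rule lex_compare_coordinates[OF P assms(5) q C'A maximal_chainD(2)[OF C']])
        show "(\<Sum>\<sigma>\<in>?A. (real_of_rat (?v \<sigma>) * k \<sigma>) *\<^sub>R q \<sigma>)
            = (\<Sum>\<sigma>\<in>?A. (real_of_rat (w \<sigma>) * k \<sigma>) *\<^sub>R q \<sigma>)"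
          using total[OF assms(8)] total[OF C'] \<open>w = _\<close> by simp
      qed (use \<rho> above v_nonneg k coord[OF _ C'] \<open>w = _\<close> in \<open>auto intro!: mult_nonneg_nonneg simp: less_imp_le\<close>)
      then show "?v \<rho> \<le> w \<rho>"
        using k[OF \<rho>] by (simp add: of_rat_less_eq)
    qed
    then show ?thesis ..
  qed simp
  have "quasi_val P f r g = ?v"
    unfolding quasi_val_def chain_val_eigenfunction[OF r assms(6)]
    by (rule lex_min_eqI[OF r]) (use assms(8) minimal in auto)
  moreover have "real_of_rat (?v \<tau>) =
      (\<Sum>\<sigma>\<in>C. a \<sigma> * real (deg P g) / real (deg P (f \<sigma>)) * unit_vec \<sigma> \<tau>)" for \<tau>
  proof -
    have "(\<Sum>\<sigma>\<in>C. a \<sigma> * real (deg P g) / real (deg P (f \<sigma>)) * unit_vec \<sigma> \<tau>)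
        = (\<Sum>\<sigma>\<in>C. if \<sigma> = \<tau> then a \<sigma> * real (deg P g) / k \<sigma> else 0)"
      by (rule sum.cong) (auto simp: unit_vec_def k_def)
    also have "\<dots> = real_of_rat (?v \<tau>)"
      using finite_subset[OF CA fin] v_eq coord[OF _ assms(8), of \<tau>] by (simp add: sum.delta')
    finally show ?thesis by simp
  qed
  ultimately show ?thesis
    by auto
qed

end
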